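(* Let $I$ be an ideal of $R[x_1,\dots,x_n]$ and let $GB$ be the set constructed from $I$ as described in the context. Then for every polynomial $p\in I$, $p$ reduces to $0$ using $GB$.
   Context: Ring and reduction. $R$ is a commutative ring with $1$. There is a reduction relation on $R$: for $a,c\in R$ and a finite nonempty set $\{b_1,\dots,b_k\}\subseteq R$ one may have "$a\to c$ using $\{b_1,\dots,b_k\}$" (if $k=1$: "$a\to c$ by $b_1$"). We say $a$ reduces using (or by) a set if $a\to c$ using it for some $c$. For $B\subseteq R$, a reduction step using $B$ is a step using some finite nonempty subset of $B$; $a$ is in normal form using $B$ if no reduction step using $B$ applies to it; a normal form of $a$ using $B$ is an element in normal form reachable from $a$ by finitely many (possibly zero) steps using $B$. The relation $\to$ (steps using arbitrary elements of $R$) is well-founded, i.e. there is no infinite sequence of steps, and satisfies: (i) a nonzero $a$ reduces to $0$ by $b$ if $a$ is a multiple of $b$; (ii) if $a\to c$ using $\{b_1,\dots,b_k\}$ then $a-c\in(b_1,\dots,b_k)$; (iii) if $a$ reduces using $\{b_1,\dots,b_k\}$ and each $b_i$ reduces by $\{c_1,\dots,c_j\}$, then $a$ also reduces by $\{c_1,\dots,c_j\}$. A basis (generating set) $B$ of an ideal of $R$ is a weak Gröbner basis if every element of the ideal has $0$ as a normal form using $B$. Every ideal of $R$ is assumed to have a finite weak Gröbner basis. Orderings. Terms are power products of $x_1,\dots,x_n$, with a fixed admissible total well-ordering (compatible with multiplication, $1$ least). A monomial is $ct$ with $c\in R$ nonzero and $t$ a term. For nonzero $p\in R[x_1,\dots,x_n]$,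 $HD(p)$, $HT(p)$, $HC(p)$ are its head-monomial, head-term, head-coefficient, so $HD(p)=HC(p)\cdot HT(p)$, and $Rest(p)=p-HD(p)$; these functions apply elementwise to sets (for an ideal, to its nonzero elements). On $R$ put $a<c$ iff there is a nonempty reduction sequence $c\to c_1\to\dots\to a$. On monomials, $ct<c't'$ iff $t<t'$, or $t=t'$ and $c<c'$. On polynomials, $p<q$ iff $p=0\neq q$, or $p,q\ne0$ and either $HD(p)<HD(q)$, or $HD(p)=HD(q)$ and $Rest(p)<Rest(q)$. Polynomial reduction. $p\to q$ using nonzero polynomials $\{p_1,\dots,p_k\}$ iff there is a monomial $ct$ of $p$ ($p=ct+p'$, $c$ the coefficient of $t$ in $p$) such that each $HT(p_i)$ divides $t$, say $t=t_i'\cdot HT(p_i)$, and there are $d,k_1,\dots,k_k\in R$ with $c\to d$ using $\{HC(p_1),\dots,HC(p_k)\}$, $c=\sum_i k_i\, HC(p_i)+d$ and $q=p-\sum_i k_i t_i' p_i$. A step using a set of polynomials is a step using some finite nonempty subset; "$p$ reduces to $0$ using $S$" means that some finite (possibly empty) sequence of steps using $S$ leads from $p$ to $0$. Minimal monomials. For a set $M$ of monomials, $MinMon(M)$ is the set of $m\in M$ such that no $m'\in M$ properly divides $m$ (i.e. $m'\mid m$ but $m\nmid m'$). For $t\in HT(MinMon(HD(I)))$, $D(t,I)$ is the set of all coefficients of $t$ in $MinMon(HD(I))$. Construction of $GB$. For each $t\in HT(MinMon(HD(I)))$ let $G(t,I)$ be a finite weak Gröbner basis of the ideal of $R$ generated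 by $D(t,I)$. For each nonzero $g\in G(t,I)$, include in $GB$ one polynomial of $I$ which is minimal with respect to $<$ among the polynomials in $I$ with head-monomial $g\cdot t$.
   Formalization: Added assumption: for each t, the nonzero elements of G(t,I) still form a weak Gröbner basis of the ideal generated by D(t,I); without it the claim fails when G(t,I) contains 0 and 0 is needed in a reducing set. *)

theory Defs
  imports Complex_Main "HOL-Library.Poly_Mapping"
begin

section \<open>Ideals\<close>

text \<open>Ideals of a commutative ring are its submodules as a module over itself; the same
  notions serve for the coefficient ring and for the polynomial ring.\<close>

lemma module_times: "module ((*) :: 'a::comm_ring_1 \<Rightarrow> 'a \<Rightarrow> 'a)"
  by unfold_locales (simp_all add: algebra_simps)

abbreviation is_ideal :: "'a::comm_ring_1 set \<Rightarrow> bool"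
  where "is_ideal \<equiv> module.subspace (*)"

abbreviation ideal_of :: "'a::comm_ring_1 set \<Rightarrow> 'a set"
  where "ideal_of \<equiv> module.span (*)"


section \<open>Reduction rings\<close>

text \<open>\<open>red a B c\<close> stands for \<open>a \<rightarrow> c\<close> using \<open>B\<close>, where \<open>B\<close> is meant to be finite and nonempty.
  \<open>reducible\<close> refers to exactly this set \<open>B\<close>, whereas \<open>red_step\<close> (for a possibly infinite \<open>B\<close>)
  is a step using some finite nonempty subset of \<open>B\<close>.\<close>

type_synonym 'a reduction = "'a \<Rightarrow> 'a set \<Rightarrow> 'a \<Rightarrow> bool"

definition reducible :: "'a reduction \<Rightarrow> 'a \<Rightarrow> 'a set \<Rightarrow> bool"
  where "reducible red a B \<longleftrightarrow> (\<exists>c. red a B c)"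

definition red_step :: "'a reduction \<Rightarrow> 'a set \<Rightarrow> 'a \<Rightarrow> 'a \<Rightarrow> bool"
  where "red_step red B a c \<longleftrightarrow> (\<exists>B'\<subseteq>B. finite B' \<and> B' \<noteq> {} \<and> red a B' c)"

definition in_normal_form :: "'a reduction \<Rightarrow> 'a set \<Rightarrow> 'a \<Rightarrow> bool"
  where "in_normal_form red B a \<longleftrightarrow> \<not> (\<exists>c. red_step red B a c)"

definition is_normal_form_of :: "'a reduction \<Rightarrow> 'a set \<Rightarrow> 'a \<Rightarrow> 'a \<Rightarrow> bool"
  where "is_normal_form_of red B a c \<longleftrightarrow> (red_step red B)\<^sup>*\<^sup>* a c \<and> in_normal_form red B c"

definition weak_groebner_basis :: "'a::comm_ring_1 reduction \<Rightarrow> 'a set \<Rightarrow> 'a set \<Rightarrow> bool"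
  where "weak_groebner_basis red B J \<longleftrightarrow>
    ideal_of B = J \<and> (\<forall>a\<in>J. is_normal_form_of red B a 0)"

locale reduction_ring =
  fixes red :: "'a::comm_ring_1 reduction"
  assumes red_finite_nonempty: "red a B c \<Longrightarrow> finite B \<and> B \<noteq> {}"
    and red_wf: "wfp (\<lambda>c a. red_step red UNIV a c)"
    and red_multiple: "a \<noteq> 0 \<Longrightarrow> b dvd a \<Longrightarrow> red a {b} 0"
    and red_diff_in_ideal: "red a B c \<Longrightarrow> a - c \<in> ideal_of B"
    and reducible_trans:
      "finite C \<Longrightarrow> C \<noteq> {} \<Longrightarrow> reducible red a B \<Longrightarrow> (\<And>b. b \<in> B \<Longrightarrow> reducible red b C)
        \<Longrightarrow> reducible red a C"
    and ex_weak_groebner_basis: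
      "is_ideal J \<Longrightarrow> \<exists>B. finite B \<and> weak_groebner_basis red B J"


section \<open>Terms, polynomials and their orderings\<close>

text \<open>A term is identified with its exponent vector, so that multiplication of terms is addition
  and the term \<open>1\<close> is \<open>0\<close>. The number of variables is \<open>CARD('x)\<close>. The monomial \<open>c \<cdot> t\<close> is the
  polynomial \<^term>\<open>Poly_Mapping.single t c\<close> with \<^prop>\<open>c \<noteq> 0\<close>.\<close>

type_synonym 'x pterm = "'x \<Rightarrow>\<^sub>0 nat"
type_synonym ('x, 'a) mpoly = "'x pterm \<Rightarrow>\<^sub>0 'a"
type_synonym 'x term_order = "'x pterm \<Rightarrow> 'x pterm \<Rightarrow> bool"

definition strict :: "'x term_order \<Rightarrow> 'x pterm \<Rightarrow> 'x pterm \<Rightarrow> bool"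
  where "strict le s t \<longleftrightarrow> le s t \<and> \<not> le t s"

definition admissible :: "'x term_order \<Rightarrow> bool"
  where "admissible le \<longleftrightarrow> class.wellorder le (strict le) \<and> (\<forall>t. le 0 t) \<and>
    (\<forall>s t u. le s t \<longrightarrow> le (s + u) (t + u))"

text \<open>The following four functions are meant for nonzero polynomials only.\<close>

definition HT :: "'x term_order \<Rightarrow> ('x, 'a::zero) mpoly \<Rightarrow> 'x pterm"
  where "HT le p = linorder.Max le (Poly_Mapping.keys p)"

definition HC :: "'x term_order \<Rightarrow> ('x, 'a::zero) mpoly \<Rightarrow> 'a"
  where "HC le p = Poly_Mapping.lookup p (HT le p)"

definition HD :: "'x term_order \<Rightarrow> ('x, 'a::zero) mpoly \<Rightarrow> ('x, 'a) mpoly"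
  where "HD le p = Poly_Mapping.single (HT le p) (HC le p)"

definition Rest :: "'x term_order \<Rightarrow> ('x, 'a::ab_group_add) mpoly \<Rightarrow> ('x, 'a) mpoly"
  where "Rest le p = p - HD le p"

definition coeff_less :: "'a reduction \<Rightarrow> 'a \<Rightarrow> 'a \<Rightarrow> bool"
  where "coeff_less red a c \<longleftrightarrow> (red_step red UNIV)\<^sup>+\<^sup>+ c a"

text \<open>For a monomial \<open>m = c \<cdot> t\<close> we have \<open>HT m = t\<close> and \<open>HC m = c\<close>.\<close>

definition monom_less ::
    "'a::zero reduction \<Rightarrow> 'x term_order \<Rightarrow> ('x, 'a) mpoly \<Rightarrow> ('x, 'a) mpoly \<Rightarrow> bool"
  where "monom_less red le m m' \<longleftrightarrow> strict le (HT le m) (HT le m') \<or>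
    HT le m = HT le m' \<and> coeff_less red (HC le m) (HC le m')"

text \<open>The number of terms decreases from \<open>p\<close> to \<open>Rest p\<close>, so the least solution of the recursive
  characterisation of the ordering is its only solution.\<close>

inductive poly_less ::
    "'a::ab_group_add reduction \<Rightarrow> 'x term_order \<Rightarrow> ('x, 'a) mpoly \<Rightarrow> ('x, 'a) mpoly \<Rightarrow> bool"
  for red le where
  zero: "q \<noteq> 0 \<Longrightarrow> poly_less red le 0 q"
| head: "p \<noteq> 0 \<Longrightarrow> q \<noteq> 0 \<Longrightarrow> monom_less red le (HD le p) (HD le q) \<Longrightarrow> poly_less red le p q"
| rest: "p \<noteq> 0 \<Longrightarrow> q \<noteq> 0 \<Longrightarrow> HD le p = HD le q \<Longrightarrow> poly_less red le (Rest le p) (Rest le q)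
    \<Longrightarrow> poly_less red le p q"


section \<open>Polynomial reduction\<close>

text \<open>\<open>poly_red red le p P q\<close> stands for \<open>p \<rightarrow> q\<close> using \<open>P\<close>. For \<open>f \<in> P\<close>, the factor \<open>k\<^sub>i t'\<^sub>i\<close>
  belonging to \<open>f\<close> is \<^term>\<open>Poly_Mapping.single (t' f) (k f)\<close>.\<close>

definition poly_red ::
    "'a::comm_ring_1 reduction \<Rightarrow> 'x term_order \<Rightarrow> ('x, 'a) mpoly \<Rightarrow> ('x, 'a) mpoly set \<Rightarrow>
      ('x, 'a) mpoly \<Rightarrow> bool"
  where "poly_red red le p P q \<longleftrightarrow> finite P \<and> P \<noteq> {} \<and> 0 \<notin> P \<and>
    (\<exists>t c d t' k. c = Poly_Mapping.lookup p t \<and> c \<noteq> 0 \<and>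
      (\<forall>f\<in>P. t = t' f + HT le f) \<and>
      red c (HC le ` P) d \<and>
      c = (\<Sum>f\<in>P. k f * HC le f) + d \<and>
      q = p - (\<Sum>f\<in>P. Poly_Mapping.single (t' f) (k f) * f))"

definition poly_red_step ::
    "'a::comm_ring_1 reduction \<Rightarrow> 'x term_order \<Rightarrow> ('x, 'a) mpoly set \<Rightarrow>
      ('x, 'a) mpoly \<Rightarrow> ('x, 'a) mpoly \<Rightarrow> bool"
  where "poly_red_step red le S p q \<longleftrightarrow>
    (\<exists>P\<subseteq>S. finite P \<and> P \<noteq> {} \<and> poly_red red le p P q)"

definition reduces_to_zero ::
    "'a::comm_ring_1 reduction \<Rightarrow> 'x term_order \<Rightarrow> ('x, 'a) mpoly set \<Rightarrow> ('x, 'a) mpoly \<Rightarrow> bool"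
  where "reduces_to_zero red le S p \<longleftrightarrow> (poly_red_step red le S)\<^sup>*\<^sup>* p 0"


section \<open>Minimal monomials and the set \<open>GB\<close>\<close>

definition MinMon :: "('x, 'a::comm_ring_1) mpoly set \<Rightarrow> ('x, 'a) mpoly set"
  where "MinMon M = {m \<in> M. \<not> (\<exists>m'\<in>M. m' dvd m \<and> \<not> m dvd m')}"

definition minimal_heads :: "'x term_order \<Rightarrow> ('x, 'a::comm_ring_1) mpoly set \<Rightarrow> ('x, 'a) mpoly set"
  where "minimal_heads le I = MinMon (HD le ` (I - {0}))"

definition minimal_head_terms :: "'x term_order \<Rightarrow> ('x, 'a::comm_ring_1) mpoly set \<Rightarrow> 'x pterm set"
  where "minimal_head_terms le I = HT le ` minimal_heads le I"

definition minimal_coeffs ::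
    "'x term_order \<Rightarrow> 'x pterm \<Rightarrow> ('x, 'a::comm_ring_1) mpoly set \<Rightarrow> 'a set"
  where "minimal_coeffs le t I = {c. Poly_Mapping.single t c \<in> minimal_heads le I}"

definition polys_with_head ::
    "'x term_order \<Rightarrow> ('x, 'a::comm_ring_1) mpoly set \<Rightarrow> 'a \<Rightarrow> 'x pterm \<Rightarrow> ('x, 'a) mpoly set"
  where "polys_with_head le I g t = {p \<in> I. p \<noteq> 0 \<and> HD le p = Poly_Mapping.single t g}"

text \<open>\<open>G t\<close> is the basis chosen for the term \<open>t\<close>, and \<open>f t g\<close> is the polynomial chosen for
  \<open>g \<cdot> t\<close>.\<close>

definition is_GB_construction ::
    "'a::comm_ring_1 reduction \<Rightarrow> 'x term_order \<Rightarrow> ('x, 'a) mpoly set \<Rightarrow> ('x pterm \<Rightarrow> 'a set) \<Rightarrow>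
      ('x, 'a) mpoly set \<Rightarrow> bool"
  where "is_GB_construction red le I G GB \<longleftrightarrow>
    (\<forall>t\<in>minimal_head_terms le I.
       finite (G t) \<and> weak_groebner_basis red (G t) (ideal_of (minimal_coeffs le t I))) \<and>
    (\<exists>f. (\<forall>t\<in>minimal_head_terms le I. \<forall>g\<in>G t - {0}.
            f t g \<in> polys_with_head le I g t \<and>
            \<not> (\<exists>q\<in>polys_with_head le I g t. poly_less red le q (f t g))) \<and>
         GB = {f t g |t g. t \<in> minimal_head_terms le I \<and> g \<in> G t - {0}})"

text \<open>Pitfall: \<open>G t\<close> may contain \<open>0\<close>, which contributes nothing to \<open>GB\<close>, and the axioms of a
  reduction ring do not guarantee that \<open>G t - {0}\<close> is still a weak Groebner basis. For example,
  let \<open>a \<rightarrow> 0\<close> using \<open>B\<close> on the integers hold iff \<open>a \<noteq> 0\<close> and \<open>B = {0, 2, 3}\<close> or \<open>B = {b}\<close> for a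
  divisor \<open>b\<close> of \<open>a\<close>. All axioms hold, \<open>{0, 2, 3}\<close> is a weak basis of the unit ideal, but \<open>1\<close> is in
  normal form using \<open>{2, 3}\<close>. The statement that \<open>GB\<close> reduces the whole ideal to \<open>0\<close> therefore
  needs the hypothesis that the sets \<open>G t - {0}\<close> are weak bases, too.\<close>

end

theory Submission
  imports Defs
begin

text \<open>Two well-founded descents carry the proof.

  The first goes down in divisibility. Since every ideal of \<open>R\<close> is finitely generated, \<open>R\<close> has no
  infinite chain of proper divisors, and hence the head monomial \<open>c \<cdot> t\<close> of any nonzero
  \<open>p \<in> I\<close> is a multiple of a minimal one, \<open>c' \<cdot> t'\<close> (\<open>minimal_head_dvd\<close>). Now \<open>c'\<close> is a nonzero
  element of the ideal generated by \<open>D(t',I)\<close>, of which the nonzero elements of \<open>G(t',I)\<close> form a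
  weak Groebner basis; the first step on the way from \<open>c'\<close> to the normal form \<open>0\<close> shows that \<open>c'\<close>
  reduces using some finite nonempty \<open>C \<subseteq> G(t',I) - {0}\<close>. By the transitivity axiom, \<open>c\<close>
  reduces using the same \<open>C\<close>, because \<open>c\<close> reduces to \<open>0\<close> by its divisor \<open>c'\<close>. The elements of
  \<open>GB\<close> with head monomials \<open>g \<cdot> t'\<close>, \<open>g \<in> C\<close>, therefore reduce \<open>p\<close> at its head.

  The second goes down in the pair of head term and head coefficient: reducing \<open>p\<close> at its head
  leaves an element of \<open>I\<close> which is zero, or has a smaller head term, or has the same head term
  and a coefficient to which the old one reduces (\<open>head_reduction\<close>). As the reduction relation of
  \<open>R\<close> is well-founded, repeated head reduction ends in \<open>0\<close>.\<close>


section \<open>Head terms for an admissible ordering\<close>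

lemma linorder_if_admissible:
  assumes "admissible le"
  shows "class.linorder le (strict le)"
  using assms unfolding admissible_def class.wellorder_def by blast

lemma wfp_strict:
  assumes "admissible le"
  shows "wfp (strict le)"
proof -
  interpret wellorder le "strict le"
    using assms by (simp add: admissible_def)
  show ?thesis
    by (rule wfp_on_less)
qed

lemma admissible_antisym:
  assumes "admissible le" and "le s t" and "le t s"
  shows "s = t"
proof -
  interpret linorder le "strict le"
    using assms(1) by (rule linorder_if_admissible)
  show ?thesis
    using assms(2,3) by (rule order.antisym)
qed

lemma admissible_add_left:
  assumes "admissible le" and "le s t"
  shows "le (u + s) (u + t)"
  using assms unfolding admissible_def by (metis add.commute)

lemma admissible_le_add:
  assumes "admissible le"
  shows "le s (s + u)"
  using admissible_add_left[OF assms, of 0 u s] assms by (simp add: admissible_def)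

lemma HT_in_keys:
  assumes "admissible le" and "p \<noteq> 0"
  shows "HT le p \<in> Poly_Mapping.keys p"
proof -
  interpret linorder le "strict le"
    using assms(1) by (rule linorder_if_admissible)
  show ?thesis
    using assms(2) Max_in[of "Poly_Mapping.keys p"] by (simp add: HT_def)
qed

lemma le_HT:
  assumes "admissible le" and "Poly_Mapping.lookup p t \<noteq> 0"
  shows "le t (HT le p)"
proof -
  interpret linorder le "strict le"
    using assms(1) by (rule linorder_if_admissible)
  show ?thesis
    using assms(2) Max_ge[of "Poly_Mapping.keys p" t] by (simp add: HT_def in_keys_iff)
qed

lemma HC_nonzero:
  assumes "admissible le" and "p \<noteq> 0"
  shows "HC le p \<noteq> 0"
  using HT_in_keys[OF assms] by (simp add: HC_def in_keys_iff)

lemma HT_single: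
  assumes "admissible le" and "c \<noteq> 0"
  shows "HT le (Poly_Mapping.single t c) = t"
proof -
  interpret linorder le "strict le"
    using assms(1) by (rule linorder_if_admissible)
  show ?thesis
    using assms(2) by (simp add: HT_def)
qed

lemma HD_eq_single_iff:
  assumes "admissible le" and "p \<noteq> 0"
  shows "HD le p = Poly_Mapping.single t c \<longleftrightarrow> HT le p = t \<and> HC le p = c"
proof
  assume *: "HD le p = Poly_Mapping.single t c"
  have "Poly_Mapping.lookup (Poly_Mapping.single t c) (HT le p) \<noteq> 0"
    using HC_nonzero[OF assms] by (simp flip: * add: HD_def)
  then have "HT le p = t"
    by (metis lookup_single_not_eq)
  with * show "HT le p = t \<and> HC le p = c"
    by (metis HD_def lookup_single_eq)
qed (simp add: HD_def)

text \<open>The shape of the descent in both halves of the argument; only the relation on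
  coefficients differs: proper divisibility in one, reduction in the other.\<close>

lemma head_induct:
  assumes "admissible le" and "wfp r"
    and step: "\<And>p. (\<And>q. strict le (HT le q) (HT le p) \<or>
        HT le q = HT le p \<and> r (HC le q) (HC le p) \<Longrightarrow> Q q) \<Longrightarrow> Q p"
  shows "Q p"
proof -
  let ?R = "inv_image ({(s, t). strict le s t} <*lex*> {(c, d). r c d}) (\<lambda>p. (HT le p, HC le p))"
  have "wf ?R"
    using wfp_strict[OF assms(1)] assms(2) by (intro wf_inv_image wf_lex_prod) (simp_all add: wfp_def)
  then show ?thesis
  proof (induction p rule: wf_induct_rule)
    case (less p)
    show ?case
      by (rule step, rule less.IH) auto
  qed
qed


section \<open>Products with monomials\<close>

lemma lookup_single_mult:
  fixes s u :: "'x pterm" and f :: "('x, 'a::comm_ring_1) mpoly"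
  shows "Poly_Mapping.lookup (Poly_Mapping.single s k * f) (s + u) = k * Poly_Mapping.lookup f u"
proof (transfer fixing: s u k)
  fix f :: "'x pterm \<Rightarrow> 'a"
  have "prod_fun (\<lambda>k'. k when s = k') f (s + u) = (\<Sum>l. k * (\<Sum>q. f q when s + u = l + q) when s = l)"
    by (simp add: prod_fun_def when_mult)
  also have "\<dots> = k * (\<Sum>q. f q when s + u = s + q)"
    by simp
  also have "(\<Sum>q. f q when s + u = s + q) = f u"
    by simp
  finally show "prod_fun (\<lambda>k'. k when s = k') f (s + u) = k * f u" .
qed

lemma lookup_single_mult_nonzeroE:
  fixes s t :: "'x pterm" and f :: "('x, 'a::comm_ring_1) mpoly"
  assumes "Poly_Mapping.lookup (Poly_Mapping.single s k * f) t \<noteq> 0"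
  obtains u where "t = s + u" and "Poly_Mapping.lookup f u \<noteq> 0"
proof -
  have "t \<in> Poly_Mapping.keys (Poly_Mapping.single s k * f)"
    using assms by (simp add: in_keys_iff)
  then obtain a u where "t = a + u" "a \<in> Poly_Mapping.keys (Poly_Mapping.single s k)"
      "u \<in> Poly_Mapping.keys f"
    using keys_mult[of "Poly_Mapping.single s k" f] by blast
  then show ?thesis
    by (intro that[of u]) (auto simp: in_keys_iff lookup_single when_def split: if_splits)
qed

lemma single_dvd_single_iff:
  fixes s t :: "'x pterm" and c d :: "'a::comm_ring_1"
  assumes "d \<noteq> 0"
  shows "Poly_Mapping.single s c dvd Poly_Mapping.single t d \<longleftrightarrow> (\<exists>u. t = s + u) \<and> c dvd d"
proof
  assume "Poly_Mapping.single s c dvd Poly_Mapping.single t d"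
  then obtain r where r: "Poly_Mapping.single t d = Poly_Mapping.single s c * r"
    by (rule dvdE)
  have d: "d = Poly_Mapping.lookup (Poly_Mapping.single s c * r) t"
    by (simp flip: r)
  with assms obtain u where "t = s + u"
    using lookup_single_mult_nonzeroE by metis
  with d show "(\<exists>u. t = s + u) \<and> c dvd d"
    by (auto simp: lookup_single_mult)
next
  assume "(\<exists>u. t = s + u) \<and> c dvd d"
  then obtain u k where "t = s + u" "d = c * k"
    by auto
  then have "Poly_Mapping.single t d = Poly_Mapping.single s c * Poly_Mapping.single u k"
    by (simp add: mult_single)
  then show "Poly_Mapping.single s c dvd Poly_Mapping.single t d"
    by simp
qed


section \<open>Minimal head monomials\<close>

text \<open>The divisors in an infinite chain of proper divisors would generate an ideal without a finite
  basis: a finite subset of the ideal consists of multiples of a single divisor in the chain.\<close>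

lemma (in reduction_ring) wfp_proper_dvd:
  "wfp (\<lambda>a b::'a. a dvd b \<and> \<not> b dvd a)"
proof -
  interpret R: module "(*) :: 'a \<Rightarrow> 'a \<Rightarrow> 'a"
    by (rule module_times)
  have "\<nexists>h::nat \<Rightarrow> 'a. \<forall>i. h (Suc i) dvd h i \<and> \<not> h i dvd h (Suc i)"
  proof
    assume "\<exists>h::nat \<Rightarrow> 'a. \<forall>i. h (Suc i) dvd h i \<and> \<not> h i dvd h (Suc i)"
    then obtain h :: "nat \<Rightarrow> 'a"
      where h: "\<And>i. h (Suc i) dvd h i" and proper: "\<And>i. \<not> h i dvd h (Suc i)"
      by blast
    have mono: "h j dvd h i" if "i \<le> j" for i j
      using that by (induction rule: dec_induct) (auto intro: dvd_trans h)
    define J where "J = {x. \<exists>i. h i dvd x}"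
    have "x + y \<in> J" if xy: "x \<in> J" "y \<in> J" for x y
    proof -
      obtain i j where "h i dvd x" "h j dvd y"
        using xy by (auto simp: J_def)
      then have "h (max i j) dvd x" "h (max i j) dvd y"
        using mono[of i "max i j"] mono[of j "max i j"] by (auto intro: dvd_trans)
      then show ?thesis
        unfolding J_def by (blast intro: dvd_add)
    qed
    then have "is_ideal J"
      unfolding R.subspace_def by (auto simp: J_def intro: dvd_mult)
    then obtain B where "finite B" and span: "ideal_of B = J"
      using ex_weak_groebner_basis unfolding weak_groebner_basis_def by blast
    have "B \<subseteq> J"
      using R.span_superset span by blast
    then have "\<forall>b\<in>B. \<exists>i. h i dvd b"
      by (auto simp: J_def)
    then obtain \<iota> where \<iota>: "\<And>b. b \<in> B \<Longrightarrow> h (\<iota> b) dvd b"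
      by metis
    define N where "N = (\<Sum>b\<in>B. \<iota> b)"
    have "h N dvd b" if "b \<in> B" for b
      using \<iota>[OF that] mono[of "\<iota> b" N] member_le_sum[of b B \<iota>] that \<open>finite B\<close>
      by (auto simp: N_def intro: dvd_trans)
    then have "B \<subseteq> {x. h N dvd x}"
      by blast
    moreover have "is_ideal {x. h N dvd x}"
      unfolding R.subspace_def by auto
    ultimately have "J \<subseteq> {x. h N dvd x}"
      using R.span_minimal span by blast
    moreover have "h (Suc N) \<in> J"
      unfolding J_def using dvd_refl by blast
    ultimately show False
      using proper by blast
  qed
  then show ?thesis
    by (simp add: wfp_def wf_iff_no_infinite_down_chain)
qed

text \<open>A proper divisor of a monomial has a smaller term, or the same term and a coefficient that is a
  proper divisor; so passing from head monomials to proper divisors among them must stop.\<close>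

lemma minimal_head_dvd:
  fixes red :: "'a::comm_ring_1 reduction" and I :: "('x, 'a) mpoly set"
  assumes "reduction_ring red" and "admissible le"
    and "p \<in> I" and "p \<noteq> 0"
  shows "\<exists>q\<in>I - {0}. HD le q \<in> minimal_heads le I \<and> HD le q dvd HD le p"
proof -
  have "p \<in> I - {0} \<longrightarrow> ?thesis"
  proof (induction p rule: head_induct[OF assms(2) reduction_ring.wfp_proper_dvd[OF assms(1)]])
    case (1 p)
    show ?case
    proof (intro impI, cases "HD le p \<in> minimal_heads le I")
      case False
      assume p: "p \<in> I - {0}"
      with False obtain q where q: "q \<in> I - {0}"
        and dvd: "HD le q dvd HD le p" and ndvd: "\<not> HD le p dvd HD le q"
        by (auto simp: minimal_heads_def MinMon_def)
      have HC: "HC le p \<noteq> 0" "HC le q \<noteq> 0"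
        using p q by (simp_all add: HC_nonzero[OF assms(2)])
      obtain u where u: "HT le p = HT le q + u" and HC_dvd: "HC le q dvd HC le p"
        using dvd HC by (auto simp: HD_def single_dvd_single_iff)
      have le: "le (HT le q) (HT le p)"
        using admissible_le_add[OF assms(2)] by (simp add: u)
      have "strict le (HT le q) (HT le p) \<or>
        HT le q = HT le p \<and> HC le q dvd HC le p \<and> \<not> HC le p dvd HC le q"
      proof (cases "HT le q = HT le p")
        case True
        then have "\<not> HC le p dvd HC le q"
          using ndvd HC by (auto simp: HD_def single_dvd_single_iff intro: exI[of _ 0])
        with True HC_dvd show ?thesis
          by simp
      next
        case False
        then show ?thesis
          using le admissible_antisym[OF assms(2)] by (auto simp: strict_def)
      qed
      then show "\<exists>q\<in>I - {0}. HD le q \<in> minimal_heads le I \<and> HD le q dvd HD le p"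
        using 1 q dvd dvd_trans by blast
    qed auto
  qed
  with assms(3,4) show ?thesis
    by blast
qed


section \<open>Reduction at the head\<close>

text \<open>The products subtracted from \<open>p\<close> have no term above \<open>HT p\<close>, and at \<open>HT p\<close> they change the
  coefficient to \<open>d\<close>.\<close>

lemma head_reduction:
  fixes p :: "('x, 'a::comm_ring_1) mpoly"
  assumes "admissible le"
    and HT: "\<And>f. f \<in> P \<Longrightarrow> HT le p = t' f + HT le f"
    and HC: "HC le p = (\<Sum>f\<in>P. k f * HC le f) + d"
    and q: "q = p - (\<Sum>f\<in>P. Poly_Mapping.single (t' f) (k f) * f)"
    and "q \<noteq> 0"
  shows "strict le (HT le q) (HT le p) \<or> HT le q = HT le p \<and> HC le q = d"
proof -
  have "Poly_Mapping.lookup (Poly_Mapping.single (t' f) (k f) * f) (HT le p) = k f * HC le f"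
    if "f \<in> P" for f
    using lookup_single_mult[of "t' f" "k f" f "HT le f"] by (simp add: HT[OF that] HC_def)
  then have coeff: "Poly_Mapping.lookup q (HT le p) = d"
    using HC by (simp add: q lookup_minus lookup_sum HC_def[of le p])
  have "le (HT le q) (HT le p)"
  proof (cases "Poly_Mapping.lookup p (HT le q) = 0")
    case True
    have "Poly_Mapping.lookup q (HT le q) \<noteq> 0"
      using HC_nonzero[OF assms(1) \<open>q \<noteq> 0\<close>] by (simp add: HC_def)
    with True have "(\<Sum>f\<in>P. Poly_Mapping.lookup (Poly_Mapping.single (t' f) (k f) * f) (HT le q)) \<noteq> 0"
      by (simp add: q lookup_minus lookup_sum)
    then obtain f where "f \<in> P"
      and "Poly_Mapping.lookup (Poly_Mapping.single (t' f) (k f) * f) (HT le q) \<noteq> 0"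
      by (meson sum.not_neutral_contains_not_neutral)
    then obtain u where "HT le q = t' f + u" "Poly_Mapping.lookup f u \<noteq> 0"
      using lookup_single_mult_nonzeroE by metis
    then show ?thesis
      using le_HT[OF assms(1)] admissible_add_left[OF assms(1)] HT[OF \<open>f \<in> P\<close>] by metis
  next
    case False
    then show ?thesis
      by (rule le_HT[OF assms(1)])
  qed
  then show ?thesis
    using admissible_antisym[OF assms(1), of "HT le q" "HT le p"] coeff
    by (cases "HT le q = HT le p") (auto simp: strict_def HC_def)
qed

text \<open>Injectivity of \<open>HC\<close> on \<open>P\<close> lets the coefficients that express \<open>HC p - d\<close> by head
  coefficients be read as coefficients of the elements of \<open>P\<close>.\<close>

lemma reduces_to_zero_if_heads_reducible:
  fixes red :: "'a::comm_ring_1 reduction" and S :: "('x, 'a) mpoly set"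
  assumes "reduction_ring red" and "admissible le" and "is_ideal I" and "S \<subseteq> I - {0}"
    and heads: "\<And>p. p \<in> I \<Longrightarrow> p \<noteq> 0 \<Longrightarrow> \<exists>P\<subseteq>S. inj_on (HC le) P \<and>
      (\<forall>f\<in>P. \<exists>u. HT le p = u + HT le f) \<and> reducible red (HC le p) (HC le ` P)"
    and "p \<in> I"
  shows "reduces_to_zero red le S p"
proof -
  interpret reduction_ring red
    by (fact assms(1))
  interpret R: module "(*) :: 'a \<Rightarrow> 'a \<Rightarrow> 'a"
    by (rule module_times)
  interpret M: module "(*) :: ('x, 'a) mpoly \<Rightarrow> _ \<Rightarrow> _"
    by (rule module_times)
  have "p \<in> I \<longrightarrow> reduces_to_zero red le S p"
  proof (induction p rule: head_induct[OF assms(2) red_wf])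
    case (1 p)
    show ?case
    proof (intro impI, cases "p = 0")
      case True
      then show "reduces_to_zero red le S p"
        by (simp add: reduces_to_zero_def)
    next
      case False
      assume "p \<in> I"
      obtain P d where P: "P \<subseteq> S" "inj_on (HC le) P"
        and "\<forall>f\<in>P. \<exists>u. HT le p = u + HT le f" and red: "red (HC le p) (HC le ` P) d"
        using heads[OF \<open>p \<in> I\<close> False] unfolding reducible_def by blast
      then obtain t' where t': "\<And>f. f \<in> P \<Longrightarrow> HT le p = t' f + HT le f"
        by metis
      have finite: "finite P" "P \<noteq> {}"
        using red_finite_nonempty[OF red] finite_imageD[OF _ P(2)] by auto
      obtain v where "HC le p - d = (\<Sum>b\<in>HC le ` P. v b * b)"
        using red_diff_in_ideal[OF red] finite by (auto simp: R.span_finite)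
      then have HC: "HC le p = (\<Sum>f\<in>P. v (HC le f) * HC le f) + d"
        by (simp add: sum.reindex[OF P(2)] algebra_simps)
      define q where "q = p - (\<Sum>f\<in>P. Poly_Mapping.single (t' f) (v (HC le f)) * f)"
      have "poly_red red le p P q"
        unfolding poly_red_def using finite P(1) assms(4) HC_nonzero[OF assms(2) False] t' red HC q_def
        by (intro conjI exI[of _ "HT le p"] exI[of _ "HC le p"] exI[of _ d] exI[of _ t']
            exI[of _ "\<lambda>f. v (HC le f)"]) (auto simp: HC_def)
      then have step: "poly_red_step red le S p q"
        unfolding poly_red_step_def using P(1) finite by blast
      have "q \<in> I"
        unfolding q_def using \<open>p \<in> I\<close> P(1) assms(4)
        by (intro M.subspace_diff[OF assms(3)] M.subspace_sum[OF assms(3)]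
            M.subspace_scale[OF assms(3)]) auto
      have "reduces_to_zero red le S q"
      proof (cases "q = 0")
        case True
        then show ?thesis
          by (simp add: reduces_to_zero_def)
      next
        case False
        have "red_step red UNIV (HC le p) d"
          unfolding red_step_def using red red_finite_nonempty[OF red] by blast
        then show ?thesis
          using head_reduction[OF assms(2) t' HC q_def False] 1 \<open>q \<in> I\<close> by blast
      qed
      with step show "reduces_to_zero red le S p"
        unfolding reduces_to_zero_def by (rule converse_rtranclp_into_rtranclp)
    qed
  qed
  with \<open>p \<in> I\<close> show ?thesis
    by blast
qed


section \<open>The set \<open>GB\<close> reduces the ideal to zero\<close>

lemma weak_groebner_basis_reducible:
  assumes "weak_groebner_basis red B J" and "a \<in> J" and "a \<noteq> 0"
  obtains C where "C \<subseteq> B" and "finite C" and "C \<noteq> {}" and "reducible red a C"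
proof -
  have "(red_step red B)\<^sup>*\<^sup>* a 0"
    using assms(1,2) by (simp add: weak_groebner_basis_def is_normal_form_of_def)
  then obtain c where "red_step red B a c"
    using assms(3) by (auto elim: converse_rtranclpE)
  then show ?thesis
    using that unfolding red_step_def reducible_def by blast
qed

theorem theorem5p2:
  fixes red :: "'a::comm_ring_1 reduction"
    and le :: "'x::finite term_order"
    and I GB :: "('x, 'a) mpoly set"
    and G :: "'x pterm \<Rightarrow> 'a set"
  assumes "reduction_ring red"
    and "admissible le"
    and "is_ideal I"
    and "is_GB_construction red le I G GB"
    and zero_dispensable: "\<forall>t\<in>minimal_head_terms le I.
      weak_groebner_basis red (G t - {0}) (ideal_of (minimal_coeffs le t I))"
  shows "\<forall>p\<in>I. reduces_to_zero red le GB p"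
proof -
  interpret reduction_ring red
    by (fact assms(1))
  interpret R: module "(*) :: 'a \<Rightarrow> 'a \<Rightarrow> 'a"
    by (rule module_times)
  obtain f where
    f: "\<And>t g. t \<in> minimal_head_terms le I \<Longrightarrow> g \<in> G t - {0} \<Longrightarrow> f t g \<in> polys_with_head le I g t"
    and GB: "GB = {f t g |t g. t \<in> minimal_head_terms le I \<and> g \<in> G t - {0}}"
    using assms(4) unfolding is_GB_construction_def by blast
  have "GB \<subseteq> I - {0}"
    using f by (auto simp: GB polys_with_head_def)
  moreover have "\<exists>P\<subseteq>GB. inj_on (HC le) P \<and> (\<forall>f\<in>P. \<exists>u. HT le p = u + HT le f) \<and>
      reducible red (HC le p) (HC le ` P)" if "p \<in> I" "p \<noteq> 0" for p
  proof -
    obtain q where q: "q \<in> I - {0}" "HD le q \<in> minimal_heads le I" "HD le q dvd HD le p"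
      using minimal_head_dvd[OF assms(1,2) \<open>p \<in> I\<close> \<open>p \<noteq> 0\<close>] by blast
    define t where "t = HT le q"
    have HC: "HC le p \<noteq> 0" "HC le q \<noteq> 0"
      using q(1) \<open>p \<noteq> 0\<close> by (simp_all add: HC_nonzero[OF assms(2)])
    obtain u where u: "HT le p = t + u" and dvd: "HC le q dvd HC le p"
      using q(3) HC by (auto simp: HD_def single_dvd_single_iff t_def)
    have t: "t \<in> minimal_head_terms le I"
      unfolding minimal_head_terms_def
    proof
      show "t = HT le (HD le q)"
        using HT_single[OF assms(2) HC(2)] by (simp add: HD_def t_def)
    qed (fact q(2))
    have "HC le q \<in> ideal_of (minimal_coeffs le t I)"
      using q(2) by (auto simp: minimal_coeffs_def HD_def t_def intro: R.span_base)
    with t HC(2) zero_dispensable obtain C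
      where C: "C \<subseteq> G t - {0}" "finite C" "C \<noteq> {}" "reducible red (HC le q) C"
      using weak_groebner_basis_reducible by metis
    have "reducible red (HC le p) {HC le q}"
      using red_multiple[OF HC(1) dvd] by (auto simp: reducible_def)
    then have red: "reducible red (HC le p) C"
      using reducible_trans[OF C(2,3)] C(4) by blast
    have head: "HT le (f t g) = t" "HC le (f t g) = g" if "g \<in> C" for g
      using f[OF t, of g] C(1) that HD_eq_single_iff[OF assms(2)] by (auto simp: polys_with_head_def)
    have "f t ` C \<subseteq> GB"
      using C(1) t by (auto simp: GB)
    moreover have "inj_on (HC le) (f t ` C)"
      by (auto intro!: inj_onI simp: head)
    moreover have "HC le ` f t ` C = C"
      by (force simp: head)
    moreover have "\<forall>h\<in>f t ` C. \<exists>u. HT le p = u + HT le h"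
      using u by (auto simp: head add.commute)
    ultimately show ?thesis
      using red by (intro exI[of _ "f t ` C"]) simp
  qed
  ultimately show ?thesis
    using reduces_to_zero_if_heads_reducible[OF assms(1-3)] by blast
qed

end
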